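(* Let $3\le n<\omega$, let $\mathbf F_n=\mathbf F(X)$ be the free lattice on the finite set $X$, and let $\mathbf K$ be a finitely generated lattice having $\mathbf F_n$ as an elementary sublattice. Suppose $\mathbf K$ is lower bounded. Then no join irreducible $u\in\mathbf K\setminus\mathbf F_n$ satisfies either (a) there is a join irreducible $v\in\mathbf K\setminus\mathbf F_n$ with $u\,D\,v$, or (b) $u\,D\,v$ for infinitely many $v\in\mathbf F_n$; and consequently $\mathbf K=\mathbf F_n$.
   Context: An element $a$ is join irreducible if $a=b\vee c$ implies $a=b$ or $a=c$. For $u,v\in\mathbf K$, $u\,D\,v$ means: $u\ne v$, $v$ is join irreducible, and there is $q$ with $u\le v\vee q$ but $u\not\le s\vee q$ for every $s<v$. A homomorphism $f:\mathbf M\to\mathbf K$ is lower bounded if for every $a\in\mathbf K$ the set $\{w\in\mathbf M: f(w)\ge a\}$ is either empty or has a least element; a finitely generated lattice $\mathbf K$ is lower bounded if every homomorphism from a finitely generated lattice into $\mathbf K$ is lower bounded. *)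

theory Defs
  imports "HOL-Algebra.Lattice" "HOL-Library.Countable_Set"
begin

section \<open>Sublattices, generation, homomorphisms\<close>

text \<open>A sublattice of L with universe H is the structure \<open>L\<lparr>carrier := H\<rparr>\<close>.\<close>

definition sublattice :: "('a, 'm) gorder_scheme \<Rightarrow> 'a set \<Rightarrow> bool" where
  "sublattice L H \<longleftrightarrow> H \<subseteq> carrier L \<and>
     (\<forall>x\<in>H. \<forall>y\<in>H. x \<squnion>\<^bsub>L\<^esub> y \<in> H \<and> x \<sqinter>\<^bsub>L\<^esub> y \<in> H)"

inductive_set lattice_span :: "('a, 'm) gorder_scheme \<Rightarrow> 'a set \<Rightarrow> 'a set"
  for L (structure) and S where
  incl: "x \<in> S \<Longrightarrow> x \<in> lattice_span L S"
| join: "x \<in> lattice_span L S \<Longrightarrow> y \<in> lattice_span L S \<Longrightarrow> x \<squnion> y \<in> lattice_span L S"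
| meet: "x \<in> lattice_span L S \<Longrightarrow> y \<in> lattice_span L S \<Longrightarrow> x \<sqinter> y \<in> lattice_span L S"

definition fin_gen_lattice :: "('a, 'm) gorder_scheme \<Rightarrow> bool" where
  "fin_gen_lattice L \<longleftrightarrow> lattice L \<and>
     (\<exists>S. finite S \<and> S \<subseteq> carrier L \<and> lattice_span L S = carrier L)"

definition lattice_hom ::
    "('a, 'm) gorder_scheme \<Rightarrow> ('b, 'k) gorder_scheme \<Rightarrow> ('a \<Rightarrow> 'b) set" where
  "lattice_hom L N = {f \<in> carrier L \<rightarrow> carrier N.
     \<forall>x\<in>carrier L. \<forall>y\<in>carrier L.
       f (x \<squnion>\<^bsub>L\<^esub> y) = f x \<squnion>\<^bsub>N\<^esub> f y \<and> f (x \<sqinter>\<^bsub>L\<^esub> y) = f x \<sqinter>\<^bsub>N\<^esub> f y}"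

section \<open>Free lattices\<close>

text \<open>
  The universal property quantifies over lattices whose elements are natural numbers, since a
  definition cannot quantify over types. Nothing is lost: the image of a countable set generates
  a countable sublattice. Lemma \<open>free_lattice_universal\<close> below gives the extension property
  for target lattices on an arbitrary type.
\<close>

definition free_lattice :: "('a, 'm) gorder_scheme \<Rightarrow> 'a set \<Rightarrow> bool" where
  "free_lattice L X \<longleftrightarrow> lattice L \<and> X \<subseteq> carrier L \<and> lattice_span L X = carrier L \<and>
     (\<forall>(N :: nat gorder) f. lattice N \<longrightarrow> f \<in> X \<rightarrow> carrier N \<longrightarrow>
        (\<exists>h\<in>lattice_hom L N. \<forall>x\<in>X. h x = f x))"

section \<open>First-order formulas in the language of lattices\<close>

datatype lat_term =
    LVar nat
  | LJoin lat_term lat_term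
  | LMeet lat_term lat_term

datatype lat_form =
    LEq lat_term lat_term
  | LNot lat_form
  | LAnd lat_form lat_form
  | LEx nat lat_form

primrec term_val :: "('a, 'm) gorder_scheme \<Rightarrow> (nat \<Rightarrow> 'a) \<Rightarrow> lat_term \<Rightarrow> 'a" where
  "term_val L e (LVar i) = e i"
| "term_val L e (LJoin s t) = term_val L e s \<squnion>\<^bsub>L\<^esub> term_val L e t"
| "term_val L e (LMeet s t) = term_val L e s \<sqinter>\<^bsub>L\<^esub> term_val L e t"

primrec sat :: "('a, 'm) gorder_scheme \<Rightarrow> (nat \<Rightarrow> 'a) \<Rightarrow> lat_form \<Rightarrow> bool" where
  "sat L e (LEq s t) \<longleftrightarrow> term_val L e s = term_val L e t"
| "sat L e (LNot p) \<longleftrightarrow> \<not> sat L e p"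
| "sat L e (LAnd p q) \<longleftrightarrow> sat L e p \<and> sat L e q"
| "sat L e (LEx i p) \<longleftrightarrow> (\<exists>a\<in>carrier L. sat L (e(i := a)) p)"

definition elementary_sublattice :: "('a, 'm) gorder_scheme \<Rightarrow> 'a set \<Rightarrow> bool" where
  "elementary_sublattice L H \<longleftrightarrow> sublattice L H \<and>
     (\<forall>p e. range e \<subseteq> H \<longrightarrow> (sat (L\<lparr>carrier := H\<rparr>) e p \<longleftrightarrow> sat L e p))"

section \<open>Join irreducibles, the relation D, lower boundedness\<close>

definition join_irred :: "('a, 'm) gorder_scheme \<Rightarrow> 'a \<Rightarrow> bool" where
  "join_irred L a \<longleftrightarrow> a \<in> carrier L \<and>
     (\<forall>b\<in>carrier L. \<forall>c\<in>carrier L. a = b \<squnion>\<^bsub>L\<^esub> c \<longrightarrow> a = b \<or> a = c)"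

definition D_rel :: "('a, 'm) gorder_scheme \<Rightarrow> 'a \<Rightarrow> 'a \<Rightarrow> bool" where
  "D_rel L u v \<longleftrightarrow> u \<in> carrier L \<and> v \<in> carrier L \<and> u \<noteq> v \<and> join_irred L v \<and>
     (\<exists>q\<in>carrier L. u \<sqsubseteq>\<^bsub>L\<^esub> v \<squnion>\<^bsub>L\<^esub> q \<and>
        (\<forall>s\<in>carrier L. s \<sqsubset>\<^bsub>L\<^esub> v \<longrightarrow> \<not> u \<sqsubseteq>\<^bsub>L\<^esub> s \<squnion>\<^bsub>L\<^esub> q))"

definition lower_bounded_hom ::
    "('b, 'k) gorder_scheme \<Rightarrow> ('a, 'm) gorder_scheme \<Rightarrow> ('b \<Rightarrow> 'a) \<Rightarrow> bool" where
  "lower_bounded_hom M L f \<longleftrightarrow>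
     (\<forall>a\<in>carrier L. {w \<in> carrier M. a \<sqsubseteq>\<^bsub>L\<^esub> f w} = {} \<or>
        (\<exists>m. least M m {w \<in> carrier M. a \<sqsubseteq>\<^bsub>L\<^esub> f w}))"

text \<open>
  The source lattices again have natural numbers as elements; every finitely generated lattice
  is countable, and lemma \<open>lower_bounded_lattice_universal\<close> extends the property to sources on
  an arbitrary type.
\<close>

definition lower_bounded_lattice :: "('a, 'm) gorder_scheme \<Rightarrow> bool" where
  "lower_bounded_lattice L \<longleftrightarrow> fin_gen_lattice L \<and>
     (\<forall>(M :: nat gorder) f. fin_gen_lattice M \<longrightarrow> f \<in> lattice_hom M L \<longrightarrow>
        lower_bounded_hom M L f)"

section \<open>Independence of the universe of natural numbers\<close>

lemma lattice_span_least:
  assumes "sublattice L H" "S \<subseteq> H" shows "lattice_span L S \<subseteq> H"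
proof
  fix x assume "x \<in> lattice_span L S"
  then show "x \<in> H" using assms
    by induction (auto simp: sublattice_def)
qed

lemma lattice_sublattice_carrier:
  assumes "lattice L" shows "sublattice L (carrier L)"
proof -
  interpret lattice L by fact
  show ?thesis by (auto simp: sublattice_def)
qed

lemma sublattice_span:
  assumes "lattice L" "S \<subseteq> carrier L" shows "sublattice L (lattice_span L S)"
  using lattice_span_least[OF lattice_sublattice_carrier[OF assms(1)] assms(2)]
  by (auto simp: sublattice_def intro: lattice_span.intros)

lemma is_lub_join:
  assumes "lattice L" "x \<in> carrier L" "y \<in> carrier L" "is_lub L s {x, y}"
  shows "x \<squnion>\<^bsub>L\<^esub> y = s"
proof -
  interpret lattice L by fact
  have "is_lub L (x \<squnion>\<^bsub>L\<^esub> y) {x, y}" using assms by (simp add: sup_of_two_least join_def)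
  then show ?thesis using assms(4) least_unique by blast
qed

lemma is_glb_meet:
  assumes "lattice L" "x \<in> carrier L" "y \<in> carrier L" "is_glb L s {x, y}"
  shows "x \<sqinter>\<^bsub>L\<^esub> y = s"
proof -
  interpret lattice L by fact
  have "is_glb L (x \<sqinter>\<^bsub>L\<^esub> y) {x, y}" using assms by (simp add: inf_of_two_greatest meet_def)
  then show ?thesis using assms(4) greatest_unique by blast
qed

lemma is_lub_pair_iff:
  assumes "x \<in> carrier L" "y \<in> carrier L"
  shows "is_lub L s {x, y} \<longleftrightarrow> s \<in> carrier L \<and> x \<sqsubseteq>\<^bsub>L\<^esub> s \<and> y \<sqsubseteq>\<^bsub>L\<^esub> s \<and>
    (\<forall>z\<in>carrier L. x \<sqsubseteq>\<^bsub>L\<^esub> z \<longrightarrow> y \<sqsubseteq>\<^bsub>L\<^esub> z \<longrightarrow> s \<sqsubseteq>\<^bsub>L\<^esub> z)"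
  using assms unfolding least_def Upper_def by auto

lemma is_glb_pair_iff:
  assumes "x \<in> carrier L" "y \<in> carrier L"
  shows "is_glb L s {x, y} \<longleftrightarrow> s \<in> carrier L \<and> s \<sqsubseteq>\<^bsub>L\<^esub> x \<and> s \<sqsubseteq>\<^bsub>L\<^esub> y \<and>
    (\<forall>z\<in>carrier L. z \<sqsubseteq>\<^bsub>L\<^esub> x \<longrightarrow> z \<sqsubseteq>\<^bsub>L\<^esub> y \<longrightarrow> z \<sqsubseteq>\<^bsub>L\<^esub> s)"
  using assms unfolding greatest_def Lower_def by auto

lemma join_is_lub:
  assumes "lattice L" "x \<in> carrier L" "y \<in> carrier L"
  shows "is_lub L (x \<squnion>\<^bsub>L\<^esub> y) {x, y}"
proof -
  interpret lattice L by fact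
  show ?thesis using assms by (simp add: sup_of_two_least join_def)
qed

lemma meet_is_glb:
  assumes "lattice L" "x \<in> carrier L" "y \<in> carrier L"
  shows "is_glb L (x \<sqinter>\<^bsub>L\<^esub> y) {x, y}"
proof -
  interpret lattice L by fact
  show ?thesis using assms by (simp add: inf_of_two_greatest meet_def)
qed

lemma lattice_le_emb:
  fixes L :: "('a, 'm) gorder_scheme" and N :: "('b, 'k) gorder_scheme"
  assumes L: "lattice L" and bij: "bij_betw h (carrier L) (carrier N)"
    and eq: "eq N = (=)"
    and le: "\<And>x y. x \<in> carrier L \<Longrightarrow> y \<in> carrier L \<Longrightarrow> x \<sqsubseteq>\<^bsub>L\<^esub> y \<longleftrightarrow> h x \<sqsubseteq>\<^bsub>N\<^esub> h y"
  shows "lattice N" and "h \<in> lattice_hom L N"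
    and "inv_into (carrier L) h \<in> lattice_hom N L"
proof -
  interpret L: lattice L by fact
  have im: "carrier N = h ` carrier L" using bij by (simp add: bij_betw_def)
  have inj: "inj_on h (carrier L)" using bij by (simp add: bij_betw_def)
  have lub: "is_lub N (h (x \<squnion>\<^bsub>L\<^esub> y)) {h x, h y}" if "x \<in> carrier L" "y \<in> carrier L" for x y
    using join_is_lub[OF L that] that
    by (auto simp: is_lub_pair_iff im le[symmetric])
  have glb: "is_glb N (h (x \<sqinter>\<^bsub>L\<^esub> y)) {h x, h y}" if "x \<in> carrier L" "y \<in> carrier L" for x y
    using meet_is_glb[OF L that] that
    by (auto simp: is_glb_pair_iff im le[symmetric])
  show N: "lattice N"
  proof (unfold_locales)
    show "\<And>x y z. x .=\<^bsub>N\<^esub> y \<Longrightarrow> y .=\<^bsub>N\<^esub> z \<Longrightarrow> x .=\<^bsub>N\<^esub> z" by (simp add: eq)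
    show "\<And>x. x \<in> carrier N \<Longrightarrow> x \<sqsubseteq>\<^bsub>N\<^esub> x" by (auto simp: im le[symmetric])
    show "x .=\<^bsub>N\<^esub> y"
      if xy: "x \<sqsubseteq>\<^bsub>N\<^esub> y" "y \<sqsubseteq>\<^bsub>N\<^esub> x" "x \<in> carrier N" "y \<in> carrier N" for x y
    proof -
      obtain a b where ab: "x = h a" "y = h b" "a \<in> carrier L" "b \<in> carrier L"
        using xy by (auto simp: im)
      then have "a = b" using xy by (intro L.le_antisym) (simp_all add: le)
      then show ?thesis using ab by (simp add: eq)
    qed
    show "x \<sqsubseteq>\<^bsub>N\<^esub> z" if "x \<sqsubseteq>\<^bsub>N\<^esub> y" "y \<sqsubseteq>\<^bsub>N\<^esub> z"
      "x \<in> carrier N" "y \<in> carrier N" "z \<in> carrier N" for x y z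
      using that by (auto simp: im le[symmetric] intro: L.le_trans)
    show "\<exists>s. is_lub N s {x, y}" if "x \<in> carrier N" "y \<in> carrier N" for x y
      using that lub by (auto simp: im)
    show "\<exists>s. is_glb N s {x, y}" if "x \<in> carrier N" "y \<in> carrier N" for x y
      using that glb by (auto simp: im)
  qed (auto simp: eq)
  show hom: "h \<in> lattice_hom L N"
    unfolding lattice_hom_def
    using is_lub_join[OF N _ _ lub] is_glb_meet[OF N _ _ glb] by (auto simp: im)
  show "inv_into (carrier L) h \<in> lattice_hom N L"
  proof -
    let ?g = "inv_into (carrier L) h"
    have "?g (h x \<squnion>\<^bsub>N\<^esub> h y) = x \<squnion>\<^bsub>L\<^esub> y \<and> ?g (h x \<sqinter>\<^bsub>N\<^esub> h y) = x \<sqinter>\<^bsub>L\<^esub> y"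
      if xy: "x \<in> carrier L" "y \<in> carrier L" for x y
    proof -
      have "h x \<squnion>\<^bsub>N\<^esub> h y = h (x \<squnion>\<^bsub>L\<^esub> y)" "h x \<sqinter>\<^bsub>N\<^esub> h y = h (x \<sqinter>\<^bsub>L\<^esub> y)"
        using hom xy by (auto simp: lattice_hom_def)
      then show ?thesis using xy by (simp add: inv_into_f_f[OF inj])
    qed
    then show ?thesis by (auto simp: lattice_hom_def im inv_into_f_f[OF inj])
  qed
qed

lemma lattice_hom_comp:
  assumes "f \<in> lattice_hom L M" "g \<in> lattice_hom M N"
  shows "g \<circ> f \<in> lattice_hom L N"
  using assms by (fastforce simp: lattice_hom_def Pi_iff)

lemma lattice_hom_span:
  assumes "f \<in> lattice_hom L N" "lattice L" "S \<subseteq> carrier L"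
  shows "f ` lattice_span L S = lattice_span N (f ` S)"
proof (intro equalityI subsetI)
  have sub: "lattice_span L S \<subseteq> carrier L"
    using lattice_span_least[OF lattice_sublattice_carrier] assms by blast
  fix y
  have "f x \<in> lattice_span N (f ` S)" if "x \<in> lattice_span L S" for x
    using that
  proof induction
    case (join a b)
    have "f (a \<squnion>\<^bsub>L\<^esub> b) = f a \<squnion>\<^bsub>N\<^esub> f b" using assms(1) join.hyps sub
      by (simp add: lattice_hom_def subset_iff)
    then show ?case using join by (auto intro: lattice_span.join)
  next
    case (meet a b)
    have "f (a \<sqinter>\<^bsub>L\<^esub> b) = f a \<sqinter>\<^bsub>N\<^esub> f b" using assms(1) meet.hyps sub
      by (simp add: lattice_hom_def subset_iff)
    then show ?case using meet by (auto intro: lattice_span.meet)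
  qed (auto intro: lattice_span.incl)
  then show "y \<in> lattice_span N (f ` S)" if "y \<in> f ` lattice_span L S" using that by blast
  assume "y \<in> lattice_span N (f ` S)"
  then show "y \<in> f ` lattice_span L S"
  proof induction
    case (incl y)
    then show ?case by (auto intro: lattice_span.incl)
  next
    case (join x y)
    then obtain a b where ab: "a \<in> lattice_span L S" "b \<in> lattice_span L S" "x = f a" "y = f b"
      by auto
    then have "f (a \<squnion>\<^bsub>L\<^esub> b) = x \<squnion>\<^bsub>N\<^esub> y" using assms(1) sub by (simp add: lattice_hom_def subset_iff)
    then show ?case using ab lattice_span.join by (metis imageI)
  next
    case (meet x y)
    then obtain a b where ab: "a \<in> lattice_span L S" "b \<in> lattice_span L S" "x = f a" "y = f b"
      by auto
    then have "f (a \<sqinter>\<^bsub>L\<^esub> b) = x \<sqinter>\<^bsub>N\<^esub> y" using assms(1) sub by (simp add: lattice_hom_def subset_iff)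
    then show ?case using ab lattice_span.meet by (metis imageI)
  qed
qed

instance lat_term :: countable by countable_datatype

lemma countable_lattice_span:
  assumes "countable S" shows "countable (lattice_span L S)"
proof (cases "S = {}")
  case True
  have "x \<in> lattice_span L S \<Longrightarrow> False" for x
    by (induction rule: lattice_span.induct) (auto simp: True)
  then have "lattice_span L S = {}" by auto
  then show ?thesis by simp
next
  case False
  let ?e = "from_nat_into S"
  have "x \<in> lattice_span L S \<Longrightarrow> x \<in> range (term_val L ?e)" for x
  proof (induction rule: lattice_span.induct)
    case (incl x)
    then obtain i where "?e i = x" using from_nat_into_surj[OF assms] by blast
    then have "x = term_val L ?e (LVar i)" by simp
    then show ?case by (rule range_eqI)
  next
    case (join x y)
    then obtain s t where "x = term_val L ?e s" "y = term_val L ?e t" by auto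
    then have "x \<squnion>\<^bsub>L\<^esub> y = term_val L ?e (LJoin s t)" by simp
    then show ?case by (rule range_eqI)
  next
    case (meet x y)
    then obtain s t where "x = term_val L ?e s" "y = term_val L ?e t" by auto
    then have "x \<sqinter>\<^bsub>L\<^esub> y = term_val L ?e (LMeet s t)" by simp
    then show ?case by (rule range_eqI)
  qed
  then have "lattice_span L S \<subseteq> range (term_val L ?e)" by (rule subsetI)
  then show ?thesis by (rule countable_subset) simp
qed

lemma nat_lattice_copy:
  assumes L: "lattice L" and "countable (carrier L)"
  obtains N :: "nat gorder" and h where "lattice N" "bij_betw h (carrier L) (carrier N)"
    "\<And>x y. x \<in> carrier L \<Longrightarrow> y \<in> carrier L \<Longrightarrow> x \<sqsubseteq>\<^bsub>L\<^esub> y \<longleftrightarrow> h x \<sqsubseteq>\<^bsub>N\<^esub> h y"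
    "h \<in> lattice_hom L N" "inv_into (carrier L) h \<in> lattice_hom N L"
proof -
  let ?h = "to_nat_on (carrier L)"
  let ?g = "inv_into (carrier L) ?h"
  let ?N = "\<lparr>carrier = ?h ` carrier L, eq = (=), le = (\<lambda>x y. ?g x \<sqsubseteq>\<^bsub>L\<^esub> ?g y)\<rparr> :: nat gorder"
  have inj: "inj_on ?h (carrier L)" using assms(2) by (rule inj_on_to_nat_on)
  have bij: "bij_betw ?h (carrier L) (carrier ?N)" using inj by (simp add: bij_betw_def)
  have le: "x \<sqsubseteq>\<^bsub>L\<^esub> y \<longleftrightarrow> ?h x \<sqsubseteq>\<^bsub>?N\<^esub> ?h y" if "x \<in> carrier L" "y \<in> carrier L" for x y
    using that inj by (simp add: inv_into_f_f)
  have eq: "eq ?N = (=)" by simp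
  show thesis
    by (rule that[OF lattice_le_emb(1)[OF L bij eq le] bij le
          lattice_le_emb(2)[OF L bij eq le] lattice_le_emb(3)[OF L bij eq le]])
qed

lemma sublattice_is_lattice:
  assumes L: "lattice L" and H: "sublattice L H"
  shows "lattice (L\<lparr>carrier := H\<rparr>)" and "id \<in> lattice_hom (L\<lparr>carrier := H\<rparr>) L"
proof -
  interpret L: lattice L by fact
  let ?H = "L\<lparr>carrier := H\<rparr>"
  have sub: "H \<subseteq> carrier L" using H by (simp add: sublattice_def)
  have lub: "is_lub ?H (x \<squnion>\<^bsub>L\<^esub> y) {x, y}" if "x \<in> H" "y \<in> H" for x y
    using join_is_lub[OF L, of x y] H that sub
    by (simp add: is_lub_pair_iff subset_iff) (auto simp: sublattice_def)
  have glb: "is_glb ?H (x \<sqinter>\<^bsub>L\<^esub> y) {x, y}" if "x \<in> H" "y \<in> H" for x y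
    using meet_is_glb[OF L, of x y] H that sub
    by (simp add: is_glb_pair_iff subset_iff) (auto simp: sublattice_def)
  have po: "partial_order ?H"
    using weak_partial_order_subset[OF L.weak_partial_order_axioms sub] L.eq_is_equal
    by (simp add: partial_order_def partial_order_axioms_def)
  then interpret H: partial_order ?H .
  show HL: "lattice ?H"
  proof unfold_locales
    show "\<exists>s. is_lub ?H s {x, y}" if "x \<in> carrier ?H" "y \<in> carrier ?H" for x y
      using lub[of x y] that by (intro exI) simp
    show "\<exists>s. is_glb ?H s {x, y}" if "x \<in> carrier ?H" "y \<in> carrier ?H" for x y
      using glb[of x y] that by (intro exI) simp
  qed
  show "id \<in> lattice_hom ?H L"
    unfolding lattice_hom_def
    using is_lub_join[OF HL _ _ lub] is_glb_meet[OF HL _ _ glb] sub by auto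
qed

lemma free_lattice_universal:
  fixes L :: "('a, 'm) gorder_scheme" and N :: "('b, 'k) gorder_scheme"
  assumes free: "free_lattice L X" and X: "countable X"
    and N: "lattice N" and f: "f \<in> X \<rightarrow> carrier N"
  shows "\<exists>h\<in>lattice_hom L N. \<forall>x\<in>X. h x = f x"
proof -
  let ?S = "lattice_span N (f ` X)"
  let ?N = "N\<lparr>carrier := ?S\<rparr>"
  have S: "sublattice N ?S" by (rule sublattice_span[OF N]) (use f in auto)
  note sub = sublattice_is_lattice[OF N S]
  have c: "countable (carrier ?N)" using countable_lattice_span[OF countable_image[OF X]] by simp
  obtain C :: "nat gorder" and h where "lattice C" "bij_betw h (carrier ?N) (carrier C)"
    "inv_into (carrier ?N) h \<in> lattice_hom C ?N"
    by (rule nat_lattice_copy[OF sub(1) c])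
  then have C: "lattice C" "bij_betw h ?S (carrier C)" "inv_into ?S h \<in> lattice_hom C ?N"
    by simp_all
  have fS: "f x \<in> ?S" if "x \<in> X" for x using that by (auto intro: lattice_span.incl)
  have "h \<circ> f \<in> X \<rightarrow> carrier C" using C(2) fS by (auto simp: bij_betw_def)
  then obtain k where k: "k \<in> lattice_hom L C" "\<forall>x\<in>X. k x = h (f x)"
    using free C(1) unfolding free_lattice_def by (metis comp_apply)
  have "id \<circ> (inv_into ?S h \<circ> k) \<in> lattice_hom L N"
    using lattice_hom_comp[OF lattice_hom_comp[OF k(1) C(3)] sub(2)] .
  moreover have "\<forall>x\<in>X. (id \<circ> (inv_into ?S h \<circ> k)) x = f x"
    using k(2) C(2) fS by (simp add: bij_betw_def inv_into_f_f)
  ultimately show ?thesis by blast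
qed

lemma lower_bounded_lattice_universal:
  fixes L :: "('a, 'm) gorder_scheme" and M :: "('b, 'k) gorder_scheme"
  assumes lb: "lower_bounded_lattice L" and M: "fin_gen_lattice M"
    and f: "f \<in> lattice_hom M L"
  shows "lower_bounded_hom M L f"
  unfolding lower_bounded_hom_def
proof
  fix a assume a: "a \<in> carrier L"
  obtain S where S: "finite S" "S \<subseteq> carrier M" "lattice_span M S = carrier M" and lat: "lattice M"
    using M by (auto simp: fin_gen_lattice_def)
  have "countable (carrier M)"
    using countable_lattice_span[of S M] S(1,3) by (simp add: countable_finite)
  then obtain C :: "nat gorder" and h where C: "lattice C" "bij_betw h (carrier M) (carrier C)"
    and le: "\<And>x y. x \<in> carrier M \<Longrightarrow> y \<in> carrier M \<Longrightarrow> x \<sqsubseteq>\<^bsub>M\<^esub> y \<longleftrightarrow> h x \<sqsubseteq>\<^bsub>C\<^esub> h y"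
    and h: "h \<in> lattice_hom M C" "inv_into (carrier M) h \<in> lattice_hom C M"
    using nat_lattice_copy[OF lat] by metis
  let ?g = "inv_into (carrier M) h"
  have im: "carrier C = h ` carrier M" and inj: "inj_on h (carrier M)"
    using C(2) by (auto simp: bij_betw_def)
  have "fin_gen_lattice C"
    using lattice_hom_span[OF h(1) lat S(2)] S C(1) unfolding fin_gen_lattice_def im
    by (metis finite_imageI image_mono)
  then have "lower_bounded_hom C L (f \<circ> ?g)"
    using lb lattice_hom_comp[OF h(2) f] unfolding lower_bounded_lattice_def by blast
  then have *: "{w \<in> carrier C. a \<sqsubseteq>\<^bsub>L\<^esub> (f \<circ> ?g) w} = {} \<or>
      (\<exists>m. least C m {w \<in> carrier C. a \<sqsubseteq>\<^bsub>L\<^esub> (f \<circ> ?g) w})"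
    using a unfolding lower_bounded_hom_def by blast
  let ?W = "{w \<in> carrier M. a \<sqsubseteq>\<^bsub>L\<^esub> f w}"
  have W: "{w \<in> carrier C. a \<sqsubseteq>\<^bsub>L\<^esub> (f \<circ> ?g) w} = h ` ?W"
    using inj by (auto simp: im inv_into_f_f)
  show "?W = {} \<or> (\<exists>m. least M m ?W)"
  proof (cases "?W = {}")
    case False
    then obtain m where "m \<in> ?W" "least C (h m) (h ` ?W)"
      using * unfolding W by (auto simp: least_def)
    then have "least M m ?W" using le by (auto simp: least_def)
    then show ?thesis by blast
  qed blast
qed

end

theory Submission
  imports Defs
begin

text \<open>
  Let \<open>h\<close> be a homomorphism from a finitely generated free lattice onto \<open>K\<close>, and let \<open>\<beta> a\<close> be
  the least element with \<open>h (\<beta> a) \<ge> a\<close>. The free lattice is the union of finite sets built by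
  alternately taking meets and joins, and by Whitman's condition every join cover of a meet on
  one level is refined by elements of the previous level; a minimal refinement of a cover of
  \<open>\<beta> a\<close> consists of elements of the form \<open>\<beta> b\<close>. Now argue by induction on the level of \<open>\<beta> a\<close>. If
  all nontrivial covers of \<open>a\<close> are refined by a finite set \<open>J \<subseteq> F\<close>, this is a first-order property
  of \<open>a\<close> with parameters in \<open>F\<close>. In the finitely generated lattice \<open>F\<close> only finitely many elements
  have it, since such an element is the meet of the generators and of the joins of pairs from
  \<open>J\<close> above it. By elementarity the same elements are the only ones in \<open>K\<close>, so \<open>a \<in> F\<close>.
\<close>

section \<open>Whitman's order on terms and the free lattice on countably many generators\<close>

text \<open>Whitman's rules for the word problem, without a transitivity rule: the shape of the two
  terms limits the last rule of a derivation, so Whitman's condition follows by case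
  analysis.\<close>

inductive whitman_le :: "lat_term \<Rightarrow> lat_term \<Rightarrow> bool" where
  var: "whitman_le (LVar i) (LVar i)"
| join_left: "whitman_le s u \<Longrightarrow> whitman_le t u \<Longrightarrow> whitman_le (LJoin s t) u"
| meet_right: "whitman_le u s \<Longrightarrow> whitman_le u t \<Longrightarrow> whitman_le u (LMeet s t)"
| meet_left1: "whitman_le s u \<Longrightarrow> whitman_le (LMeet s t) u"
| meet_left2: "whitman_le t u \<Longrightarrow> whitman_le (LMeet s t) u"
| join_right1: "whitman_le u s \<Longrightarrow> whitman_le u (LJoin s t)"
| join_right2: "whitman_le u t \<Longrightarrow> whitman_le u (LJoin s t)"

lemma whitman_le_refl: "whitman_le t t"
  by (induction t) (auto intro: whitman_le.intros)

lemma whitman_le_join_leftD: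
  assumes "whitman_le r u" "r = LJoin s t" shows "whitman_le s u \<and> whitman_le t u"
  using assms by induction (auto intro: whitman_le.intros)

text \<open>Cut elimination by induction on the total size. If the first derivation introduces
  \<open>t\<close> on the right, inversion (for a join) or the last rule of the second derivation
  (for a meet) replaces \<open>t\<close> by a part of it; otherwise the cut moves past a rule acting
  on \<open>s\<close> or \<open>u\<close>.\<close>

lemma whitman_le_trans: "whitman_le s t \<Longrightarrow> whitman_le t u \<Longrightarrow> whitman_le s u"
proof (induction "size s + size t + size u" arbitrary: s t u rule: less_induct)
  case less
  from less.prems(1) show ?case
  proof cases
    case (var i)
    then show ?thesis using less.prems(2) by simp
  next
    case (join_left s1 s2)
    then have "whitman_le s1 u" "whitman_le s2 u"
      using less.hyps[of s1 t u] less.hyps[of s2 t u] less.prems(2) by simp_all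
    then show ?thesis using join_left by (simp add: whitman_le.join_left)
  next
    case (meet_left1 s1 s2)
    then show ?thesis using less.hyps[of s1 t u] less.prems by (simp add: whitman_le.meet_left1)
  next
    case (meet_left2 s1 s2)
    then show ?thesis using less.hyps[of s1 t u] less.prems by (simp add: whitman_le.meet_left2)
  next
    case (join_right1 t1 t2)
    then have "whitman_le t1 u" using less.prems(2) whitman_le_join_leftD by blast
    then show ?thesis using join_right1 less.hyps[of s t1 u] by simp
  next
    case (join_right2 t2 t1)
    then have "whitman_le t2 u" using less.prems(2) whitman_le_join_leftD by blast
    then show ?thesis using join_right2 less.hyps[of s t2 u] by simp
  next
    case (meet_right t1 t2)
    from less.prems(2) show ?thesis
    proof cases
      case (meet_right u1 u2)
      then show ?thesis using less.hyps[of s t u1] less.hyps[of s t u2] less.prems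
        by (simp add: whitman_le.meet_right)
    next
      case (join_right1 u1 u2)
      then show ?thesis using less.hyps[of s t u1] less.prems by (simp add: whitman_le.join_right1)
    next
      case (join_right2 u2 u1)
      then show ?thesis using less.hyps[of s t u2] less.prems by (simp add: whitman_le.join_right2)
    next
      case (meet_left1 s1 s2)
      then show ?thesis using meet_right less.hyps[of s s1 u] by simp
    next
      case (meet_left2 s2 s1)
      then show ?thesis using meet_right less.hyps[of s s2 u] by simp
    qed (use meet_right in auto)
  qed
qed

\<comment> \<open>The free lattice as a quotient of terms\<close>
quotient_type free_lat = lat_term / "\<lambda>s t. whitman_le s t \<and> whitman_le t s"
  by (intro equivpI reflpI sympI transpI) (auto intro: whitman_le_refl whitman_le_trans)

instantiation free_lat :: "{order, inf, sup}"
begin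

lift_definition less_eq_free_lat :: "free_lat \<Rightarrow> free_lat \<Rightarrow> bool" is whitman_le
  using whitman_le_trans by blast

definition less_free_lat :: "free_lat \<Rightarrow> free_lat \<Rightarrow> bool" where
  "less_free_lat x y \<longleftrightarrow> x \<le> y \<and> \<not> y \<le> x"

lift_definition sup_free_lat :: "free_lat \<Rightarrow> free_lat \<Rightarrow> free_lat" is LJoin
  by (auto intro: whitman_le.intros)

lift_definition inf_free_lat :: "free_lat \<Rightarrow> free_lat \<Rightarrow> free_lat" is LMeet
  by (auto intro: whitman_le.intros)

instance
proof
  fix x y z :: free_lat
  show "x < y \<longleftrightarrow> x \<le> y \<and> \<not> y \<le> x" by (rule less_free_lat_def)
  show "x \<le> x" by transfer (rule whitman_le_refl)
  show "x \<le> y \<Longrightarrow> y \<le> z \<Longrightarrow> x \<le> z" by transfer (rule whitman_le_trans)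
  show "x \<le> y \<Longrightarrow> y \<le> x \<Longrightarrow> x = y" by transfer simp
qed

end

instance free_lat :: "{Lattices.lattice}"
proof
  fix x y z :: free_lat
  show "inf x y \<le> x" "inf x y \<le> y"
    by (transfer, auto intro: whitman_le.intros whitman_le_refl)+
  show "x \<le> y \<Longrightarrow> x \<le> z \<Longrightarrow> x \<le> inf y z"
    by transfer (auto intro: whitman_le.intros)
  show "x \<le> sup x y" "y \<le> sup x y"
    by (transfer, auto intro: whitman_le.intros whitman_le_refl)+
  show "y \<le> x \<Longrightarrow> z \<le> x \<Longrightarrow> sup y z \<le> x"
    by transfer (auto intro: whitman_le.intros)
qed

lift_definition free_gen :: "nat \<Rightarrow> free_lat" is LVar .

lemma free_gen_join_prime: "free_gen i \<le> sup y z \<Longrightarrow> free_gen i \<le> y \<or> free_gen i \<le> z"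
  by transfer (auto elim: whitman_le.cases)

text \<open>The alternatives match the four rules that can end a derivation of a meet below a
  join.\<close>

lemma whitman_condition:
  fixes x y u v :: free_lat
  assumes "inf x y \<le> sup u v"
  shows "x \<le> sup u v \<or> y \<le> sup u v \<or> inf x y \<le> u \<or> inf x y \<le> v"
  using assms by transfer (auto elim: whitman_le.cases)

section \<open>Covers and elementary sublattices\<close>

definition LLe :: "lat_term \<Rightarrow> lat_term \<Rightarrow> lat_form" where
  "LLe s t = LEq (LJoin s t) t"

definition LImp :: "lat_form \<Rightarrow> lat_form \<Rightarrow> lat_form" where
  "LImp p q = LNot (LAnd p (LNot q))"

definition LAll :: "nat \<Rightarrow> lat_form \<Rightarrow> lat_form" where
  "LAll i p = LNot (LEx i (LNot p))"

primrec LDisj :: "lat_form list \<Rightarrow> lat_form" where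
  "LDisj [] = LNot (LEq (LVar 0) (LVar 0))"
| "LDisj (p # ps) = LNot (LAnd (LNot p) (LNot (LDisj ps)))"

lemma sat_LImp [simp]: "sat L e (LImp p q) \<longleftrightarrow> (sat L e p \<longrightarrow> sat L e q)"
  by (simp add: LImp_def)

lemma sat_LAll [simp]: "sat L e (LAll i p) \<longleftrightarrow> (\<forall>a\<in>carrier L. sat L (e(i := a)) p)"
  by (simp add: LAll_def)

lemma sat_LDisj [simp]: "sat L e (LDisj ps) \<longleftrightarrow> (\<exists>p\<in>set ps. sat L e p)"
  by (induction ps) auto

context Lattice.lattice
begin

lemma join_eq_right_iff: "x \<in> carrier L \<Longrightarrow> y \<in> carrier L \<Longrightarrow> x \<squnion> y = y \<longleftrightarrow> x \<sqsubseteq> y"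
  by (metis join_le join_left join_right join_closed le_antisym le_refl)

lemma term_val_closed: "range e \<subseteq> carrier L \<Longrightarrow> term_val L e t \<in> carrier L"
  by (induction t) auto

lemma sat_LLe: "range e \<subseteq> carrier L \<Longrightarrow> sat L e (LLe s t) \<longleftrightarrow> term_val L e s \<sqsubseteq> term_val L e t"
  by (simp add: LLe_def join_eq_right_iff term_val_closed)

end

text \<open>Only two-element covers are tested, so for finite \<open>J\<close> this is a first-order
  property of \<open>u\<close> with parameters in \<open>J\<close>.\<close>

definition cover_refines :: "('a, 'm) gorder_scheme \<Rightarrow> 'a set \<Rightarrow> 'a \<Rightarrow> bool" where
  "cover_refines L J u \<longleftrightarrow> (\<forall>b\<in>carrier L. \<forall>c\<in>carrier L. u \<sqsubseteq>\<^bsub>L\<^esub> b \<squnion>\<^bsub>L\<^esub> c \<longrightarrow>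
     u \<sqsubseteq>\<^bsub>L\<^esub> b \<or> u \<sqsubseteq>\<^bsub>L\<^esub> c \<or>
     (\<exists>g\<in>J. \<exists>h\<in>J. u \<sqsubseteq>\<^bsub>L\<^esub> g \<squnion>\<^bsub>L\<^esub> h \<and> g \<sqsubseteq>\<^bsub>L\<^esub> b \<and> h \<sqsubseteq>\<^bsub>L\<^esub> c))"

text \<open>
  Variables 0, 1, 2 play the roles of \<open>u\<close>, \<open>b\<close>, \<open>c\<close> in \<open>cover_refines\<close>; the variables in \<open>is\<close> and
  \<open>qs\<close>, which must be at least 3, are parameters.
\<close>

definition cover_form :: "nat list \<Rightarrow> nat list \<Rightarrow> lat_form" where
  "cover_form is qs = LAll 0 (LImp
     (LAll 1 (LAll 2 (LImp (LLe (LVar 0) (LJoin (LVar 1) (LVar 2)))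
        (LDisj (LLe (LVar 0) (LVar 1) # LLe (LVar 0) (LVar 2) #
           map (\<lambda>(i, j). LAnd (LLe (LVar 0) (LJoin (LVar i) (LVar j)))
                          (LAnd (LLe (LVar i) (LVar 1)) (LLe (LVar j) (LVar 2))))
             (List.product is is))))))
     (LDisj (map (\<lambda>q. LEq (LVar 0) (LVar q)) qs)))"

lemma sat_cover_form:
  assumes L: "Lattice.lattice L" and e: "range e \<subseteq> carrier L"
    and ge: "\<And>i. i \<in> set is \<union> set qs \<Longrightarrow> 3 \<le> i"
  shows "sat L e (cover_form is qs) \<longleftrightarrow>
    (\<forall>u\<in>carrier L. cover_refines L (e ` set is) u \<longrightarrow> u \<in> e ` set qs)"
proof -
  interpret L: Lattice.lattice L by fact
  \<comment> \<open>Rebinding variables 0, 1, 2 must leave the values of the parameters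
    unchanged.\<close>
  have neq: "i \<noteq> 0 \<and> i \<noteq> 1 \<and> i \<noteq> 2 \<and> i \<noteq> Suc 0" if "i \<in> set is \<union> set qs" for i
    using ge[OF that] by auto
  have LLe: "sat L (e(0 := u, 1 := b, 2 := c)) (LLe s t) \<longleftrightarrow>
      term_val L (e(0 := u, 1 := b, 2 := c)) s \<sqsubseteq>\<^bsub>L\<^esub> term_val L (e(0 := u, 1 := b, 2 := c)) t"
    if "u \<in> carrier L" "b \<in> carrier L" "c \<in> carrier L" for u b c s t
    using that e by (intro L.sat_LLe) auto
  have cov: "sat L (e(0 := u, 1 := b, 2 := c))
        (LDisj (map (\<lambda>(i, j). LAnd (LLe (LVar 0) (LJoin (LVar i) (LVar j)))
            (LAnd (LLe (LVar i) (LVar 1)) (LLe (LVar j) (LVar 2)))) (List.product is is))) \<longleftrightarrow>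
      (\<exists>g\<in>e ` set is. \<exists>h\<in>e ` set is. u \<sqsubseteq>\<^bsub>L\<^esub> g \<squnion>\<^bsub>L\<^esub> h \<and> g \<sqsubseteq>\<^bsub>L\<^esub> b \<and> h \<sqsubseteq>\<^bsub>L\<^esub> c)"
    if u: "u \<in> carrier L" "b \<in> carrier L" "c \<in> carrier L" for u b c
  proof -
    have "sat L (e(0 := u, 1 := b, 2 := c)) (LAnd (LLe (LVar 0) (LJoin (LVar i) (LVar j)))
            (LAnd (LLe (LVar i) (LVar 1)) (LLe (LVar j) (LVar 2)))) \<longleftrightarrow>
        u \<sqsubseteq>\<^bsub>L\<^esub> e i \<squnion>\<^bsub>L\<^esub> e j \<and> e i \<sqsubseteq>\<^bsub>L\<^esub> b \<and> e j \<sqsubseteq>\<^bsub>L\<^esub> c"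
      if "i \<in> set is" "j \<in> set is" for i j
      using neq[of i] neq[of j] that by (simp only: sat.simps LLe[OF u]) simp
    then show ?thesis by (simp add: case_prod_beta)
  qed
  have hyp: "sat L (e(0 := u)) (LAll 1 (LAll 2 (LImp (LLe (LVar 0) (LJoin (LVar 1) (LVar 2)))
        (LDisj (LLe (LVar 0) (LVar 1) # LLe (LVar 0) (LVar 2) #
           map (\<lambda>(i, j). LAnd (LLe (LVar 0) (LJoin (LVar i) (LVar j)))
                          (LAnd (LLe (LVar i) (LVar 1)) (LLe (LVar j) (LVar 2))))
             (List.product is is)))))) \<longleftrightarrow> cover_refines L (e ` set is) u"
    if u: "u \<in> carrier L" for u
    unfolding cover_refines_def sat_LAll sat_LImp LDisj.simps sat.simps(2,3)
    by (intro ball_cong refl) (simp only: cov[OF u] LLe[OF u], simp, blast)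
  have concl: "sat L (e(0 := u)) (LDisj (map (\<lambda>q. LEq (LVar 0) (LVar q)) qs)) \<longleftrightarrow> u \<in> e ` set qs"
    for u using neq by auto
  show ?thesis
    unfolding cover_form_def by (subst sat_LAll, rule ball_cong[OF refl], subst sat_LImp, simp only: hyp concl)
qed

text \<open>
  In a lattice generated by \<open>X\<close>, an element whose covers are refined by \<open>J\<close> is the meet of
  those elements of \<open>X\<close> and those joins of pairs from \<open>J\<close> that lie above it.
\<close>

lemma finite_cover_refines:
  assumes L: "fin_gen_lattice L" and J: "finite J" "J \<subseteq> carrier L"
  shows "\<exists>Q. finite Q \<and> Q \<subseteq> carrier L \<and> (\<forall>u\<in>carrier L. cover_refines L J u \<longrightarrow> u \<in> Q)"
proof -
  obtain X where X: "finite X" "X \<subseteq> carrier L" "lattice_span L X = carrier L"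
    and lat: "Lattice.lattice L" using L by (auto simp: fin_gen_lattice_def)
  interpret L: Lattice.lattice L by fact
  \<comment> \<open>\<open>P\<close> collects all candidates for meetands and \<open>Q\<close> their
    nonempty meets; both are fixed before \<open>u\<close>.\<close>
  define P where "P = X \<union> (\<lambda>(g, h). g \<squnion>\<^bsub>L\<^esub> h) ` (J \<times> J)"
  have P: "finite P" "P \<subseteq> carrier L" using X J by (auto simp: P_def intro!: L.join_closed)
  define Q where "Q = (\<lambda>B. \<Sqinter>\<^bsub>L\<^esub>B) ` {B. B \<subseteq> P \<and> B \<noteq> {}}"
  have Q: "Q \<subseteq> carrier L" using P finite_subset[of _ P] by (auto simp: Q_def intro!: L.finite_inf_closed)
  have "finite Q" unfolding Q_def using P(1) by simp
  moreover have "u \<in> Q" if u: "u \<in> carrier L" "cover_refines L J u" for u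
  proof -
    let ?B = "{p \<in> P. u \<sqsubseteq>\<^bsub>L\<^esub> p}"
    have B: "finite ?B" "?B \<subseteq> carrier L" using P by auto
    note glb = L.finite_inf_greatest[OF B]
    have below: "?B \<noteq> {} \<and> \<Sqinter>\<^bsub>L\<^esub>?B \<sqsubseteq>\<^bsub>L\<^esub> p" if "p \<in> P" "u \<sqsubseteq>\<^bsub>L\<^esub> p" for p
    proof -
      have ne: "?B \<noteq> {}" using that by blast
      show ?thesis using greatest_Lower_below[OF glb[OF ne]] that B(2) ne by blast
    qed
    \<comment> \<open>The case \<open>t = u\<close> gives the missing inequality. Nonemptiness of
      \<open>?B\<close> is carried along because the lattice need not have a greatest
      element.\<close>
    have span: "?B \<noteq> {} \<and> \<Sqinter>\<^bsub>L\<^esub>?B \<sqsubseteq>\<^bsub>L\<^esub> t" if "t \<in> lattice_span L X" "u \<sqsubseteq>\<^bsub>L\<^esub> t" for t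
      using that
    proof (induction rule: lattice_span.induct)
      case (incl x)
      then show ?case by (intro below) (auto simp: P_def)
    next
      case (meet x y)
      have c: "x \<in> carrier L" "y \<in> carrier L" using meet.hyps X(3) by auto
      have "u \<sqsubseteq>\<^bsub>L\<^esub> x" "u \<sqsubseteq>\<^bsub>L\<^esub> y"
        using meet.prems c u(1) L.meet_left[OF c] L.meet_right[OF c] by (meson L.le_trans L.meet_closed)+
      then have "?B \<noteq> {}" "\<Sqinter>\<^bsub>L\<^esub>?B \<sqsubseteq>\<^bsub>L\<^esub> x" "\<Sqinter>\<^bsub>L\<^esub>?B \<sqsubseteq>\<^bsub>L\<^esub> y" using meet.IH by auto
      moreover have "\<Sqinter>\<^bsub>L\<^esub>?B \<in> carrier L" using B calculation(1) by (rule L.finite_inf_closed)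
      ultimately show ?case using c by (simp add: L.meet_le)
    next
      case (join x y)
      have c: "x \<in> carrier L" "y \<in> carrier L" using join.hyps X(3) by auto
      have le: ?case
        if "?B \<noteq> {} \<and> \<Sqinter>\<^bsub>L\<^esub>?B \<sqsubseteq>\<^bsub>L\<^esub> z" "z \<sqsubseteq>\<^bsub>L\<^esub> x \<squnion>\<^bsub>L\<^esub> y" "z \<in> carrier L" for z
        using that c L.le_trans[OF _ that(2)] L.finite_inf_closed[OF B] by simp
      have "u \<sqsubseteq>\<^bsub>L\<^esub> x \<or> u \<sqsubseteq>\<^bsub>L\<^esub> y \<or>
        (\<exists>g\<in>J. \<exists>h\<in>J. u \<sqsubseteq>\<^bsub>L\<^esub> g \<squnion>\<^bsub>L\<^esub> h \<and> g \<sqsubseteq>\<^bsub>L\<^esub> x \<and> h \<sqsubseteq>\<^bsub>L\<^esub> y)"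
        using u(2) c join.prems by (simp add: cover_refines_def)
      then consider "u \<sqsubseteq>\<^bsub>L\<^esub> x" | "u \<sqsubseteq>\<^bsub>L\<^esub> y"
        | g h where "g \<in> J" "h \<in> J" "u \<sqsubseteq>\<^bsub>L\<^esub> g \<squnion>\<^bsub>L\<^esub> h" "g \<sqsubseteq>\<^bsub>L\<^esub> x" "h \<sqsubseteq>\<^bsub>L\<^esub> y"
        by blast
      then show ?case
      proof cases
        case 1
        then show ?thesis using le[OF join.IH(1)] c L.join_left by simp
      next
        case 2
        then show ?thesis using le[OF join.IH(2)] c L.join_right by simp
      next
        case 3
        have gc: "g \<in> carrier L" "h \<in> carrier L" using 3 J by auto
        have "g \<sqsubseteq>\<^bsub>L\<^esub> x \<squnion>\<^bsub>L\<^esub> y" "h \<sqsubseteq>\<^bsub>L\<^esub> x \<squnion>\<^bsub>L\<^esub> y"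
          using 3 gc c L.join_left[OF c] L.join_right[OF c] by (meson L.le_trans L.join_closed)+
        then have "g \<squnion>\<^bsub>L\<^esub> h \<sqsubseteq>\<^bsub>L\<^esub> x \<squnion>\<^bsub>L\<^esub> y" using gc c by (simp add: L.join_le)
        moreover have "g \<squnion>\<^bsub>L\<^esub> h \<in> P" using 3 by (auto simp: P_def)
        ultimately show ?thesis using le[OF below[OF _ 3(3)]] gc by simp
      qed
    qed
    have ne: "?B \<noteq> {}" and le: "\<Sqinter>\<^bsub>L\<^esub>?B \<sqsubseteq>\<^bsub>L\<^esub> u" using span[of u] u X by auto
    have "u \<sqsubseteq>\<^bsub>L\<^esub> \<Sqinter>\<^bsub>L\<^esub>?B"
      using greatest_le[OF glb[OF ne]] u(1) B(2) by (auto simp: Lower_def)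
    then have "u = \<Sqinter>\<^bsub>L\<^esub>?B" using le u L.finite_inf_closed[OF B ne] by (intro L.le_antisym)
    then show ?thesis using ne by (auto simp: Q_def)
  qed
  ultimately show ?thesis using Q by blast
qed

text \<open>In \<open>F\<close> the elements refined by \<open>J\<close> lie in a finite set
  \<open>Q\<close>. This is a single formula with parameters from \<open>F\<close>, so it also holds
  in \<open>K\<close>.\<close>

lemma elementary_cover_refines:
  assumes K: "Lattice.lattice K" and el: "elementary_sublattice K F"
    and F: "fin_gen_lattice (K\<lparr>carrier := F\<rparr>)" and ne: "F \<noteq> {}"
    and J: "finite J" "J \<subseteq> F" and u: "u \<in> carrier K" "cover_refines K J u"
  shows "u \<in> F"
proof -
  let ?F = "K\<lparr>carrier := F\<rparr>"
  have lat: "Lattice.lattice ?F" using F by (simp add: fin_gen_lattice_def)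
  have FK: "F \<subseteq> carrier K" using el by (simp add: elementary_sublattice_def sublattice_def)
  obtain Q where Q: "finite Q" "Q \<subseteq> F" "\<forall>u\<in>F. cover_refines ?F J u \<longrightarrow> u \<in> Q"
    using finite_cover_refines[OF F, of J] J by auto
  obtain js qs where js: "set js = J" and qs: "set qs = Q"
    using finite_list J(1) Q(1) by metis
  obtain x where x: "x \<in> F" using ne by blast
  \<comment> \<open>Variables from 3 on list \<open>J\<close> and then \<open>Q\<close>; all others,
    including 0, 1, 2, get the default \<open>x\<close>, which keeps the range of \<open>e\<close>
    inside \<open>F\<close>.\<close>
  define e where "e i = (if 3 \<le> i \<and> i < 3 + length (js @ qs) then (js @ qs) ! (i - 3) else x)" for i
  have "(js @ qs) ! i \<in> F" if "i < length (js @ qs)" for i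
    using nth_mem[OF that] J Q js qs by auto
  then have e: "range e \<subseteq> F" using x by (auto simp: e_def simp del: length_append)
  define ji qi where "ji = [3..<3 + length js]"
    and "qi = [3 + length js..<3 + length js + length qs]"
  have eJ: "e ` set ji = J"
  proof -
    have "map e ji = js" by (rule nth_equalityI) (auto simp: ji_def e_def nth_append)
    then show ?thesis using js by (metis set_map)
  qed
  have eQ: "e ` set qi = Q"
  proof -
    have "map e qi = qs" by (rule nth_equalityI) (auto simp: qi_def e_def nth_append)
    then show ?thesis using qs by (metis set_map)
  qed
  have ge: "\<And>i. i \<in> set ji \<union> set qi \<Longrightarrow> 3 \<le> i" by (auto simp: ji_def qi_def)
  have "sat ?F e (cover_form ji qi)"
    using sat_cover_form[OF lat _ ge] e Q(3) by (simp add: eJ eQ)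
  then have "sat K e (cover_form ji qi)" using el e by (auto simp: elementary_sublattice_def)
  then have "u \<in> Q" using sat_cover_form[OF K _ ge] e FK u by (auto simp: eJ eQ)
  then show ?thesis using Q by blast
qed

section \<open>Join covers in a lattice satisfying Whitman's condition\<close>

locale whitman_generators =
  fixes S :: "'w::Lattices.lattice set"
  assumes finite_gens: "finite S"
    and gens_join_prime: "s \<in> S \<Longrightarrow> s \<le> sup y z \<Longrightarrow> s \<le> y \<or> s \<le> z"
    and whitman: "inf (x::'w) y \<le> sup u v \<Longrightarrow>
      x \<le> sup u v \<or> y \<le> sup u v \<or> inf x y \<le> u \<or> inf x y \<le> v"
begin

section \<open>Finite levels of the lattice generated by \<open>S\<close>\<close>

primrec joins :: "nat \<Rightarrow> 'w set" where
  "joins 0 = {}"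
| "joins (Suc k) =
     {Sup_fin B |B. B \<noteq> {} \<and> B \<subseteq> {Inf_fin A |A. A \<noteq> {} \<and> A \<subseteq> S \<union> joins k}}"

text \<open>The intermediate layer of the recursion: it contains \<open>joins k\<close> and is
  contained in \<open>joins (Suc k)\<close>.\<close>

definition meets :: "nat \<Rightarrow> 'w set" where
  "meets k = {Inf_fin A |A. A \<noteq> {} \<and> A \<subseteq> S \<union> joins k}"

lemma joins_Suc: "joins (Suc k) = {Sup_fin B |B. B \<noteq> {} \<and> B \<subseteq> meets k}"
  by (simp add: meets_def)

declare joins.simps(2) [simp del]

lemma finite_joins: "finite (joins k)" and finite_meets: "finite (meets k)"
proof -
  have *: "finite (meets k)" if "finite (joins k)" for k
  proof -
    have "finite (Inf_fin ` Pow (S \<union> joins k))" using that finite_gens by simp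
    then show ?thesis by (rule rev_finite_subset) (auto simp: meets_def)
  qed
  show fj: "finite (joins k)"
  proof (induction k)
    case (Suc k)
    have "finite (Sup_fin ` Pow (meets k))" using *[OF Suc] by simp
    then show ?case by (rule rev_finite_subset) (auto simp: joins_Suc)
  qed simp
  show "finite (meets k)" by (rule *[OF fj])
qed

lemma gens_subset_meets: "S \<subseteq> meets k"
  and joins_subset_meets: "joins k \<subseteq> meets k"
proof -
  have "x \<in> meets k" if "x \<in> S \<union> joins k" for x
    unfolding meets_def using that by (intro CollectI exI[of _ "{x}"]) simp
  then show "S \<subseteq> meets k" "joins k \<subseteq> meets k" by auto
qed

lemma meets_subset_joins: "meets k \<subseteq> joins (Suc k)"
proof
  fix x assume "x \<in> meets k"
  then show "x \<in> joins (Suc k)"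
    unfolding joins_Suc by (intro CollectI exI[of _ "{x}"]) simp
qed

lemma joins_mono: "k \<le> l \<Longrightarrow> joins k \<subseteq> joins l"
  by (rule lift_Suc_mono_le) (use joins_subset_meets meets_subset_joins in blast)

lemma sup_in_joins:
  assumes "x \<in> joins k" "y \<in> joins k" shows "sup x y \<in> joins k"
proof (cases k)
  case (Suc l)
  obtain A B where AB: "x = Sup_fin A" "A \<noteq> {}" "A \<subseteq> meets l" "y = Sup_fin B" "B \<noteq> {}" "B \<subseteq> meets l"
    using assms by (auto simp: Suc joins_Suc)
  then have "sup x y = Sup_fin (A \<union> B)"
    using finite_subset[OF _ finite_meets] by (simp add: Sup_fin.union)
  then show ?thesis using AB by (auto simp: Suc joins_Suc)
qed (use assms in simp)

lemma inf_in_meets: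
  assumes "x \<in> meets k" "y \<in> meets k" shows "inf x y \<in> meets k"
proof -
  obtain A B where AB: "x = Inf_fin A" "A \<noteq> {}" "A \<subseteq> S \<union> joins k"
    "y = Inf_fin B" "B \<noteq> {}" "B \<subseteq> S \<union> joins k"
    using assms by (auto simp: meets_def)
  then have "inf x y = Inf_fin (A \<union> B)"
    using finite_subset[of _ "S \<union> joins k"] finite_gens finite_joins by (simp add: Inf_fin.union)
  then show ?thesis using AB by (auto simp: meets_def)
qed

lemma joins_subset_closed:
  assumes "S \<subseteq> T" "\<And>x y. x \<in> T \<Longrightarrow> y \<in> T \<Longrightarrow> sup x y \<in> T"
    and "\<And>x y. x \<in> T \<Longrightarrow> y \<in> T \<Longrightarrow> inf x y \<in> T"
  shows "joins k \<subseteq> T"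
proof (induction k)
  case (Suc k)
  have Inf: "Inf_fin A \<in> T" if "finite A" "A \<noteq> {}" "A \<subseteq> T" for A
    using that by (induction A rule: finite_ne_induct) (auto simp: assms)
  have Sup: "Sup_fin A \<in> T" if "finite A" "A \<noteq> {}" "A \<subseteq> T" for A
    using that by (induction A rule: finite_ne_induct) (auto simp: assms)
  have "finite (S \<union> joins k)" using finite_gens finite_joins by simp
  then have meets: "meets k \<subseteq> T"
    using Suc assms(1) by (auto simp: meets_def intro!: Inf finite_subset[of _ "S \<union> joins k"])
  show ?case
  proof
    fix x assume "x \<in> joins (Suc k)"
    then obtain B where B: "x = Sup_fin B" "B \<noteq> {}" "B \<subseteq> meets k" by (auto simp: joins_Suc)
    have "finite B" using B(3) finite_meets by (rule finite_subset)
    then show "x \<in> T" using B meets by (auto intro!: Sup)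
  qed
qed simp

lemma gens_subset_UN_joins: "S \<subseteq> (\<Union>k. joins k)"
  using gens_subset_meets meets_subset_joins by blast

lemma UN_joins_closed:
  assumes "x \<in> (\<Union>k. joins k)" "y \<in> (\<Union>k. joins k)"
  shows "sup x y \<in> (\<Union>k. joins k)" "inf x y \<in> (\<Union>k. joins k)"
proof -
  obtain k l where "x \<in> joins k" "y \<in> joins l" using assms by blast
  then have xy: "x \<in> joins (max k l)" "y \<in> joins (max k l)"
    using joins_mono[of k "max k l"] joins_mono[of l "max k l"] by auto
  then show "sup x y \<in> (\<Union>k. joins k)" using sup_in_joins by blast
  have "inf x y \<in> meets (max k l)" using xy joins_subset_meets by (blast intro: inf_in_meets)
  then show "inf x y \<in> (\<Union>k. joins k)" using meets_subset_joins by blast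
qed

section \<open>Refinement of a single cover by elements of a level\<close>

definition refines :: "'w set \<Rightarrow> 'w \<Rightarrow> 'w \<Rightarrow> 'w \<Rightarrow> bool" where
  "refines G w y z \<longleftrightarrow> w \<le> y \<or> w \<le> z \<or>
     (\<exists>g\<in>G. \<exists>h\<in>G. w \<le> sup g h \<and> g \<le> y \<and> h \<le> z)"

lemma refines_down: "refines G b y z \<Longrightarrow> w \<le> b \<Longrightarrow> refines G w y z"
  unfolding refines_def by (meson order_trans)

lemma Inf_fin_whitman:
  fixes A :: "'w set"
  assumes "finite A" "A \<noteq> {}" "Inf_fin A \<le> sup y z"
  shows "Inf_fin A \<le> y \<or> Inf_fin A \<le> z \<or> (\<exists>a\<in>A. a \<le> sup y z)"
  using assms
proof (induction A rule: finite_ne_induct)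
  case (insert a A)
  then have "inf a (Inf_fin A) \<le> sup y z" by simp
  from whitman[OF this] show ?case
    using insert by (auto simp: le_infI2)
qed simp

lemma refines_mono: "refines G w y z \<Longrightarrow> G \<subseteq> G' \<Longrightarrow> refines G' w y z"
  unfolding refines_def by blast

text \<open>The parts below \<open>y\<close> are joined with each other, and so are the parts below
  \<open>z\<close>. A joinand below \<open>y\<close> or \<open>z\<close> serves as its own part,
  which is why \<open>b\<close> and \<open>c\<close> must be in \<open>G\<close>.\<close>

lemma refines_sup:
  assumes "refines G b y z" "refines G c y z" "b \<in> G" "c \<in> G"
    and cl: "\<And>g h. g \<in> G \<Longrightarrow> h \<in> G \<Longrightarrow> sup g h \<in> G"
  shows "refines G (sup b c) y z"
proof -
  have yz: ?thesis if "g \<in> G" "h \<in> G" "sup b c \<le> sup g h" "g \<le> y" "h \<le> z" for g h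
    using that unfolding refines_def by blast
  \<comment> \<open>Here \<open>d\<close> is the joinand with a trivial cover and \<open>e\<close>
    the refined one; the form \<open>sup d e\<close> serves both orders.\<close>
  have mix: ?thesis if "d \<le> y \<or> d \<le> z" "d \<in> G" "g \<in> G" "h \<in> G" "e \<le> sup g h"
      "g \<le> y" "h \<le> z" "sup b c = sup d e" for d e g h
    using that(1)
  proof
    assume "d \<le> y"
    then show ?thesis using that
      by (intro yz[of "sup d g" h]) (auto simp: cl sup.assoc intro: sup.mono le_supI2)
  next
    assume "d \<le> z"
    then show ?thesis using that
      by (intro yz[of g "sup d h"])
        (auto simp: cl sup.left_commute[of g] intro: sup.mono le_supI2)
  qed
  from assms(1) consider "b \<le> y \<or> b \<le> z"
    | g h where "g \<in> G" "h \<in> G" "b \<le> sup g h" "g \<le> y" "h \<le> z"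
    unfolding refines_def by blast
  then show ?thesis
  proof cases
    case b: 1
    from assms(2) consider "c \<le> y \<or> c \<le> z"
      | g h where "g \<in> G" "h \<in> G" "c \<le> sup g h" "g \<le> y" "h \<le> z"
      unfolding refines_def by blast
    then show ?thesis
    proof cases
      case 1
      consider "b \<le> y" "c \<le> y" | "b \<le> z" "c \<le> z" | "b \<le> y" "c \<le> z" | "b \<le> z" "c \<le> y"
        using 1 b by blast
      then show ?thesis
      proof cases
        case 3
        then show ?thesis using assms yz[of b c] by simp
      next
        case 4
        then show ?thesis using assms yz[of c b] by simp
      qed (auto simp: refines_def)
    qed (use b assms mix[of b _ _ c] in simp)
  next
    case bb: (2 g h)
    from assms(2) consider "c \<le> y \<or> c \<le> z"
      | g' h' where "g' \<in> G" "h' \<in> G" "c \<le> sup g' h'" "g' \<le> y" "h' \<le> z"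
      unfolding refines_def by blast
    then show ?thesis
    proof cases
      case 1
      then show ?thesis using bb assms(4) mix[of c g h b] by (simp add: sup.commute)
    next
      case (2 g' h')
      have "b \<le> sup (sup g g') (sup h h')" "c \<le> sup (sup g g') (sup h h')"
        using bb(3) 2(3) by (meson order_trans sup.mono sup.cobounded1 sup.cobounded2)+
      then show ?thesis using bb 2 by (intro yz[of "sup g g'" "sup h h'"]) (simp_all add: cl)
    qed
  qed
qed

text \<open>If the meet is not below \<open>y\<close> or \<open>z\<close>, Whitman's condition puts
  a meetand below \<open>sup y z\<close>. It is a join prime generator or falls under
  \<open>step\<close>, which is a hypothesis so that the induction in \<open>refines_joins\<close>
  can supply it.\<close>

lemma refines_meets_step:
  assumes w: "w \<in> meets k" "w \<le> sup y z"
    and step: "\<And>g. g \<in> joins k \<Longrightarrow> g \<le> sup y z \<Longrightarrow> refines (joins k) g y z"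
  shows "refines (joins k) w y z"
proof -
  obtain A where A: "w = Inf_fin A" "A \<noteq> {}" "A \<subseteq> S \<union> joins k"
    using w by (auto simp: meets_def)
  have fin: "finite A"
    by (rule finite_subset[OF A(3)]) (simp add: finite_gens finite_joins)
  consider "w \<le> y" | "w \<le> z" | a where "a \<in> A" "a \<le> sup y z"
    using Inf_fin_whitman[OF fin A(2)] w(2) A(1) by blast
  then show ?thesis
  proof cases
    case 3
    have wa: "w \<le> a" using 3 fin A by (simp add: Inf_fin.coboundedI)
    have "refines (joins k) a y z"
    proof (cases "a \<in> S")
      case True
      then show ?thesis using gens_join_prime 3 by (auto simp: refines_def)
    next
      case False
      then show ?thesis using step 3 A by blast
    qed
    then show ?thesis using wa by (rule refines_down)
  qed (auto simp: refines_def)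
qed

text \<open>The joinands lie in \<open>meets k\<close> and are refined there;
  \<open>refines_sup\<close> combines the results, since \<open>joins (Suc k)\<close> is closed
  under joins.\<close>

lemma refines_joins: "w \<in> joins k \<Longrightarrow> w \<le> sup y z \<Longrightarrow> refines (joins k) w y z"
proof (induction k arbitrary: w)
  case (Suc k)
  have meets: "refines (joins (Suc k)) b y z" if "b \<in> meets k" "b \<le> sup y z" for b
  proof (rule refines_mono)
    show "refines (joins k) b y z" by (rule refines_meets_step) (use that Suc.IH in auto)
    show "joins k \<subseteq> joins (Suc k)" by (rule joins_mono) simp
  qed
  obtain B where B: "w = Sup_fin B" "B \<noteq> {}" "B \<subseteq> meets k"
    using Suc.prems by (auto simp: joins_Suc)
  have "finite B" using B(3) finite_meets by (rule finite_subset)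
  then show ?case using B(2,3) Suc.prems(2) unfolding B(1)
  proof (induction B rule: finite_ne_induct)
    case (singleton b)
    then show ?case using meets by simp
  next
    case (insert b B)
    have "Sup_fin B \<in> joins (Suc k)" using insert by (auto simp: joins_Suc)
    then have "refines (joins (Suc k)) (sup b (Sup_fin B)) y z"
      using insert meets meets_subset_joins by (intro refines_sup sup_in_joins) auto
    then show ?case using insert by simp
  qed
qed simp

text \<open>The refining elements come from the level out of which \<open>w\<close> was formed by
  meets; this drop drives the later induction over levels.\<close>

lemma refines_meets: "w \<in> meets k \<Longrightarrow> w \<le> sup y z \<Longrightarrow> refines (joins k) w y z"
  by (rule refines_meets_step) (auto intro: refines_joins)

text \<open>Joinands are split off until both parts are proper; otherwise \<open>w\<close> would
  equal a single element of \<open>meets k\<close>.\<close>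

lemma joins_proper_sup:
  assumes "w \<in> joins (Suc k)" "w \<notin> meets k"
  obtains a b where "w = sup a b" "a < w" "b < w" "a \<in> joins (Suc k)" "b \<in> joins (Suc k)"
proof -
  obtain B where B: "w = Sup_fin B" "B \<noteq> {}" "B \<subseteq> meets k"
    using assms by (auto simp: joins_Suc)
  have "finite B" using B(3) finite_meets by (rule finite_subset)
  then have "\<exists>a\<in>joins (Suc k). \<exists>b\<in>joins (Suc k). w = sup a b \<and> a < w \<and> b < w"
    using B(2,3) assms(2) unfolding B(1)
  proof (induction B rule: finite_ne_induct)
    case (insert b B)
    have eq: "Sup_fin (insert b B) = sup b (Sup_fin B)" using insert by simp
    have mem: "Sup_fin B \<in> joins (Suc k)" "b \<in> joins (Suc k)"
      using insert meets_subset_joins by (auto simp: joins_Suc)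
    have "b \<noteq> sup b (Sup_fin B)" using insert.prems eq by auto
    then have b: "b < sup b (Sup_fin B)" by (simp add: less_le)
    show ?case
    proof (cases "Sup_fin B = sup b (Sup_fin B)")
      case True
      then show ?thesis using insert eq by auto
    next
      case False
      then have "Sup_fin B < sup b (Sup_fin B)" by (simp add: less_le)
      then show ?thesis using b mem unfolding eq by blast
    qed
  qed simp
  then show thesis using that by blast
qed

end

text \<open>\<open>T\<close> stands for the universe of a finitely generated free lattice mapped
  onto \<open>K\<close>, and \<open>\<beta>\<close> for the least elements that lower boundedness of
  \<open>h\<close> provides.\<close>

locale lower_bounded_image = whitman_generators S + K: Lattice.lattice K
  for S :: "'w::Lattices.lattice set" and K :: "('a, 'm) gorder_scheme" +
  fixes T :: "'w set" and h :: "'w \<Rightarrow> 'a" and \<beta> :: "'a \<Rightarrow> 'w"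
  assumes joins_subset: "joins k \<subseteq> T"
    and sup_closed: "x \<in> T \<Longrightarrow> y \<in> T \<Longrightarrow> sup x y \<in> T"
    and h_closed: "x \<in> T \<Longrightarrow> h x \<in> carrier K"
    and h_sup: "x \<in> T \<Longrightarrow> y \<in> T \<Longrightarrow> h (sup x y) = h x \<squnion>\<^bsub>K\<^esub> h y"
    and h_surj: "a \<in> carrier K \<Longrightarrow> \<exists>x\<in>T. h x = a"
    and beta_closed: "a \<in> carrier K \<Longrightarrow> \<beta> a \<in> T"
    and le_h_beta: "a \<in> carrier K \<Longrightarrow> a \<sqsubseteq>\<^bsub>K\<^esub> h (\<beta> a)"
    and beta_least: "a \<in> carrier K \<Longrightarrow> x \<in> T \<Longrightarrow> a \<sqsubseteq>\<^bsub>K\<^esub> h x \<Longrightarrow> \<beta> a \<le> x"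
begin

section \<open>Least preimages and minimal covers\<close>

lemma h_mono:
  assumes "x \<in> T" "y \<in> T" "x \<le> y" shows "h x \<sqsubseteq>\<^bsub>K\<^esub> h y"
proof -
  have "h y = h x \<squnion>\<^bsub>K\<^esub> h y" using h_sup[OF assms(1,2)] assms(3) by (simp add: sup.absorb2)
  then show ?thesis using K.join_left[of "h x" "h y"] h_closed assms by simp
qed

lemma beta_h_le: "x \<in> T \<Longrightarrow> \<beta> (h x) \<le> x"
  by (simp add: beta_least h_closed)

lemma h_beta:
  assumes "a \<in> carrier K" shows "h (\<beta> a) = a"
proof -
  obtain x where x: "x \<in> T" "h x = a" using h_surj assms by blast
  have "h (\<beta> a) \<sqsubseteq>\<^bsub>K\<^esub> a"
    using h_mono[OF beta_closed[OF assms] x(1)] beta_h_le[OF x(1)] x(2) by simp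
  then show ?thesis using le_h_beta assms beta_closed h_closed by (intro K.le_antisym) auto
qed

text \<open>Passing to least preimages does not change the image of the join, and \<open>w\<close>
  is below every element of \<open>T\<close> whose image is above \<open>h w\<close>.\<close>

lemma beta_sup_le:
  assumes "x \<in> T" "y \<in> T" "w \<le> sup x y" "w \<in> T" "\<beta> (h w) = w"
  shows "w \<le> sup (\<beta> (h x)) (\<beta> (h y))"
proof -
  have T: "\<beta> (h x) \<in> T" "\<beta> (h y) \<in> T" using assms h_closed beta_closed by auto
  have "h (sup (\<beta> (h x)) (\<beta> (h y))) = h (sup x y)"
    using assms T by (simp add: h_sup h_closed h_beta)
  moreover have "h w \<sqsubseteq>\<^bsub>K\<^esub> h (sup x y)" using assms by (simp add: h_mono sup_closed)
  ultimately show ?thesis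
    using beta_least[of "h w" "sup (\<beta> (h x)) (\<beta> (h y))"] assms T by (simp add: h_closed sup_closed)
qed

text \<open>Because \<open>h (\<beta> a) = a\<close>, the fixed points of
  \<open>\<beta> \<circ> h\<close> in \<open>T\<close> are exactly the elements
  \<open>\<beta> a\<close> with \<open>a\<close> in \<open>K\<close>.\<close>

abbreviation betas :: "'w set \<Rightarrow> 'w set" where
  "betas G \<equiv> {g \<in> G. \<beta> (h g) = g}"

text \<open>
  A cover that is minimal for refinement is not changed when its elements \<open>g\<close> are replaced by
  the smaller elements \<open>\<beta> (h g)\<close>.
\<close>

lemma refines_betas:
  assumes w: "w \<in> T" "\<beta> (h w) = w" and G: "finite G" "G \<subseteq> T" and yz: "refines G w y z"
    and ref: "\<And>y z. w \<le> sup y z \<Longrightarrow> refines G w y z"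
  shows "refines (betas G) w y z"
proof (cases "w \<le> y \<or> w \<le> z")
  case False
  define R where "R = {(a, b). a \<in> G \<and> b \<in> G \<and> w \<le> sup a b \<and> a \<le> y \<and> b \<le> z}"
  have "R \<subseteq> G \<times> G" by (auto simp: R_def)
  then have finR: "finite R" by (rule finite_subset) (use G in simp)
  have "R \<noteq> {}" using yz False by (auto simp: R_def refines_def)
  \<comment> \<open>Minimality is lexicographic: first \<open>a\<close> among all first components,
    then \<open>b\<close> among the partners of \<open>a\<close>. A pair in \<open>R\<close> below
    \<open>(a, b)\<close> in both components is therefore equal to it.\<close>
  then obtain a where a: "a \<in> fst ` R" "\<And>a'. a' \<in> fst ` R \<Longrightarrow> a' \<le> a \<Longrightarrow> a' = a"
    using finite_has_minimal[of "fst ` R"] finR by (metis finite_imageI image_is_empty)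
  have "finite {b. (a, b) \<in> R}"
    by (rule finite_subset[of _ "snd ` R"]) (use finR in force)+
  moreover have "{b. (a, b) \<in> R} \<noteq> {}" using a(1) by auto
  ultimately obtain b where b: "(a, b) \<in> R" "\<And>b'. (a, b') \<in> R \<Longrightarrow> b' \<le> b \<Longrightarrow> b' = b"
    using finite_has_minimal[of "{b. (a, b) \<in> R}"] by auto
  have ab: "a \<in> G" "b \<in> G" "w \<le> sup a b" "a \<le> y" "b \<le> z" using b(1) by (auto simp: R_def)
  have le: "\<beta> (h a) \<le> a" "\<beta> (h b) \<le> b" using ab G by (auto intro: beta_h_le)
  \<comment> \<open>The new cover is not yet known to have its members in \<open>G\<close>, so it is
    refined once more by \<open>ref\<close>.\<close>
  have "w \<le> sup (\<beta> (h a)) (\<beta> (h b))" using ab G w by (intro beta_sup_le) auto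
  then have "refines G w (\<beta> (h a)) (\<beta> (h b))" by (rule ref)
  moreover have "\<not> w \<le> \<beta> (h a)" "\<not> w \<le> \<beta> (h b)"
    using False le ab by (meson order_trans)+
  ultimately obtain c d where cd: "c \<in> G" "d \<in> G" "w \<le> sup c d" "c \<le> \<beta> (h a)" "d \<le> \<beta> (h b)"
    unfolding refines_def by blast
  have R: "(c, d) \<in> R" unfolding R_def using cd le ab by (auto intro: order_trans)
  have "c \<le> a" "d \<le> b" using cd le by (auto intro: order_trans)
  then have "c = a" "d = b" using R a(2)[of c] b(2)[of d] by force+
  then have "\<beta> (h a) = a" "\<beta> (h b) = b" using cd le by (auto intro: order.antisym)
  then show ?thesis using ab unfolding refines_def by blast
qed (auto simp: refines_def)

text \<open>A cover of \<open>h w\<close> is pulled back along \<open>\<beta>\<close> to a cover of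
  \<open>w\<close>, refined there by fixed points in \<open>joins k\<close>, and pushed forward by
  \<open>h\<close>.\<close>

lemma cover_refines_meets:
  assumes w: "w \<in> meets k" "\<beta> (h w) = w"
  shows "cover_refines K (h ` betas (joins k)) (h w)"
  unfolding cover_refines_def
proof (intro ballI impI)
  fix b c assume bc: "b \<in> carrier K" "c \<in> carrier K" "h w \<sqsubseteq>\<^bsub>K\<^esub> b \<squnion>\<^bsub>K\<^esub> c"
  have wT: "w \<in> T" using w(1) meets_subset_joins joins_subset by blast
  have T: "\<beta> b \<in> T" "\<beta> c \<in> T" using bc beta_closed by auto
  have hle: "h x \<sqsubseteq>\<^bsub>K\<^esub> d" if "x \<in> T" "d \<in> carrier K" "x \<le> \<beta> d" for x d
    using h_mono[OF that(1) beta_closed[OF that(2)] that(3)] by (simp add: h_beta that(2))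
  have "\<beta> (h w) \<le> sup (\<beta> b) (\<beta> c)"
    using bc T wT by (intro beta_least) (simp_all add: h_closed sup_closed h_sup h_beta)
  then have "refines (joins k) w (\<beta> b) (\<beta> c)" using w by (intro refines_meets) simp_all
  then have "refines (betas (joins k)) w (\<beta> b) (\<beta> c)"
    using refines_betas[OF wT w(2) finite_joins joins_subset] refines_meets[OF w(1)] by blast
  then consider "w \<le> \<beta> b" | "w \<le> \<beta> c"
    | g g' where "g \<in> betas (joins k)" "g' \<in> betas (joins k)" "w \<le> sup g g'"
      "g \<le> \<beta> b" "g' \<le> \<beta> c"
    unfolding refines_def by blast
  then show "h w \<sqsubseteq>\<^bsub>K\<^esub> b \<or> h w \<sqsubseteq>\<^bsub>K\<^esub> c \<or> (\<exists>g\<in>h ` betas (joins k). \<exists>g'\<in>h ` betas (joins k).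
      h w \<sqsubseteq>\<^bsub>K\<^esub> g \<squnion>\<^bsub>K\<^esub> g' \<and> g \<sqsubseteq>\<^bsub>K\<^esub> b \<and> g' \<sqsubseteq>\<^bsub>K\<^esub> c)"
  proof cases
    case 3
    have gT: "g \<in> T" "g' \<in> T" using 3 joins_subset by auto
    have "h w \<sqsubseteq>\<^bsub>K\<^esub> h g \<squnion>\<^bsub>K\<^esub> h g'"
      using h_mono[OF wT sup_closed[OF gT] 3(3)] by (simp add: h_sup gT)
    then show ?thesis
      using 3(1,2) hle[OF gT(1) bc(1) 3(4)] hle[OF gT(2) bc(2) 3(5)]
      by (intro disjI2 bexI[of _ "h g"] bexI[of _ "h g'"]) simp_all
  qed (use hle[OF wT bc(1)] hle[OF wT bc(2)] in simp_all)
qed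

text \<open>Induction on the level. Let \<open>w\<close> be a minimal fixed point with
  \<open>h w\<close> outside \<open>F\<close>. If \<open>w\<close> is in \<open>meets k\<close>,
  then \<open>cov\<close> applies to the finite subset of \<open>F\<close> given by the induction
  hypothesis. Otherwise \<open>w\<close> is a join of two smaller fixed points, whose images lie in
  \<open>F\<close>.\<close>

lemma h_betas_joins_subset:
  assumes F: "sublattice K F"
    and cov: "\<And>J u. finite J \<Longrightarrow> J \<subseteq> F \<Longrightarrow> u \<in> carrier K \<Longrightarrow> cover_refines K J u \<Longrightarrow> u \<in> F"
  shows "h ` betas (joins k) \<subseteq> F"
proof (induction k)
  case (Suc k)
  show ?case
  proof (rule ccontr)
    let ?N = "{w \<in> betas (joins (Suc k)). h w \<notin> F}"
    assume "\<not> ?thesis"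
    then have "?N \<noteq> {}" by blast
    moreover have "finite ?N" using finite_joins by simp
    ultimately obtain w where w: "w \<in> ?N" and min: "\<And>x. x \<in> ?N \<Longrightarrow> x \<le> w \<Longrightarrow> x = w"
      using finite_has_minimal[of ?N] by auto
    have wT: "w \<in> T" using w joins_subset by blast
    have "w \<notin> meets k"
    proof
      assume "w \<in> meets k"
      then have "cover_refines K (h ` betas (joins k)) (h w)" using w cover_refines_meets by blast
      then show False using cov[OF _ Suc.IH] w wT finite_joins h_closed by simp
    qed
    then obtain a b where ab: "w = sup a b" "a < w" "b < w"
      using w joins_proper_sup by blast
    have nle: "\<not> w \<le> a" "\<not> w \<le> b" using ab(2,3) by (simp_all add: less_le_not_le)
    \<comment> \<open>The joinands \<open>a\<close> and \<open>b\<close> need not be fixed points;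
      refining by fixed points below them keeps the join equal to \<open>w\<close>.\<close>
    have "refines (betas (joins (Suc k))) w a b"
      by (rule refines_betas[OF wT]) (use w finite_joins joins_subset ab(1) in \<open>auto intro: refines_joins\<close>)
    then obtain g g' where g: "g \<in> betas (joins (Suc k))" "g' \<in> betas (joins (Suc k))"
      "w \<le> sup g g'" "g \<le> a" "g' \<le> b"
      using nle unfolding refines_def by blast
    have "w = sup g g'" using g ab(1) by (auto intro: order.antisym sup.mono)
    then have hw: "h w = h g \<squnion>\<^bsub>K\<^esub> h g'" using g joins_subset[of "Suc k"] by (simp add: h_sup subset_iff)
    have "g < w" "g' < w" using g(4,5) ab by auto
    then have "h g \<in> F" "h g' \<in> F" using min g(1,2) by (auto simp: less_le)
    then show False using w F hw by (simp add: sublattice_def)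
  qed
qed simp

end

section \<open>The free lattice over a lower bounded lattice\<close>

definition free_lat_order :: "free_lat gorder" where
  "free_lat_order = \<lparr>carrier = UNIV, eq = (=), le = (\<le>)\<rparr>"

lemma free_lat_order_lattice: "Lattice.lattice free_lat_order"
  and join_free_lat_order: "x \<squnion>\<^bsub>free_lat_order\<^esub> y = sup x y"
  and meet_free_lat_order: "x \<sqinter>\<^bsub>free_lat_order\<^esub> y = inf x y"
proof -
  have lub: "is_lub free_lat_order (sup x y) {x, y}"
    and glb: "is_glb free_lat_order (inf x y) {x, y}" for x y
    by (simp_all add: free_lat_order_def is_lub_pair_iff is_glb_pair_iff)
  show L: "Lattice.lattice free_lat_order"
  proof unfold_locales
    show "\<exists>s. is_lub free_lat_order s {x, y}" for x y using lub by blast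
    show "\<exists>s. is_glb free_lat_order s {x, y}" for x y using glb by blast
  qed (auto simp: free_lat_order_def)
  show "x \<squnion>\<^bsub>free_lat_order\<^esub> y = sup x y"
    by (rule is_lub_join[OF L _ _ lub]) (simp_all add: free_lat_order_def)
  show "x \<sqinter>\<^bsub>free_lat_order\<^esub> y = inf x y"
    by (rule is_glb_meet[OF L _ _ glb]) (simp_all add: free_lat_order_def)
qed

text \<open>Soundness of Whitman's rules in every lattice; it makes the value of a term depend only
  on its class in \<open>free_lat\<close>.\<close>

lemma term_val_mono:
  assumes "Lattice.lattice K" "\<And>i. \<sigma> i \<in> carrier K" "whitman_le s t"
  shows "term_val K \<sigma> s \<sqsubseteq>\<^bsub>K\<^esub> term_val K \<sigma> t"
proof -
  interpret K: Lattice.lattice K by fact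
  have c [simp]: "term_val K \<sigma> t \<in> carrier K" for t
    using assms(2) by (intro K.term_val_closed) auto
  from assms(3) show ?thesis
  proof induction
    case (join_left s u t)
    then show ?case by (simp add: K.join_le)
  next
    case (meet_right u s t)
    then show ?case by (simp add: K.meet_le)
  next
    case (meet_left1 s u t)
    show ?case using K.le_trans[OF K.meet_left meet_left1.IH] by simp
  next
    case (meet_left2 t u s)
    show ?case using K.le_trans[OF K.meet_right meet_left2.IH] by simp
  next
    case (join_right1 u s t)
    show ?case using K.le_trans[OF join_right1.IH K.join_left] by simp
  next
    case (join_right2 u t s)
    show ?case using K.le_trans[OF join_right2.IH K.join_right] by simp
  qed (use assms(2) in simp)
qed

lemma free_lat_universal:
  assumes K: "Lattice.lattice K" and \<sigma>: "\<And>i. \<sigma> i \<in> carrier K"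
  shows "\<exists>h\<in>lattice_hom free_lat_order K. \<forall>i. h (free_gen i) = \<sigma> i"
proof -
  interpret K: Lattice.lattice K by fact
  \<comment> \<open>A class is evaluated at a chosen representative; \<open>term_val_mono\<close> in
    both directions shows that the choice does not matter.\<close>
  define h where "h x = term_val K \<sigma> (rep_free_lat x)" for x
  have c: "term_val K \<sigma> t \<in> carrier K" for t
    using \<sigma> by (intro K.term_val_closed) auto
  have h: "h (abs_free_lat t) = term_val K \<sigma> t" for t
  proof -
    have "whitman_le t (rep_free_lat (abs_free_lat t)) \<and> whitman_le (rep_free_lat (abs_free_lat t)) t"
      using Quotient3_rep_abs[OF Quotient3_free_lat, of t] by (simp add: whitman_le_refl)
    then show ?thesis unfolding h_def using c term_val_mono[OF K \<sigma>] by (intro K.le_antisym) auto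
  qed
  have ex: "\<exists>t. x = abs_free_lat t" for x
    by (metis Quotient3_abs_rep[OF Quotient3_free_lat])
  have "h (sup x y) = h x \<squnion>\<^bsub>K\<^esub> h y \<and> h (inf x y) = h x \<sqinter>\<^bsub>K\<^esub> h y" for x y
  proof -
    obtain s t where "x = abs_free_lat s" "y = abs_free_lat t" using ex by metis
    then show ?thesis by (simp add: sup_free_lat.abs_eq inf_free_lat.abs_eq h)
  qed
  then have "h \<in> lattice_hom free_lat_order K"
    using c by (auto simp: lattice_hom_def join_free_lat_order meet_free_lat_order h_def)
  moreover have "h (free_gen i) = \<sigma> i" for i by (simp add: free_gen.abs_eq h)
  ultimately show ?thesis by blast
qed

lemma free_gens_whitman: "finite I \<Longrightarrow> whitman_generators (free_gen ` I)"
  by unfold_locales (use free_gen_join_prime whitman_condition in auto)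

text \<open>Every \<open>a\<close> in \<open>K\<close> equals \<open>h (\<beta> a)\<close>, and
  \<open>\<beta> a\<close> is a fixed point on some level, so \<open>h_betas_joins_subset\<close>
  puts \<open>a\<close> into \<open>F\<close>.\<close>

theorem lower_bounded_elementary_extension:
  assumes lb: "lower_bounded_lattice K" and el: "elementary_sublattice K F"
    and F: "fin_gen_lattice (K\<lparr>carrier := F\<rparr>)" and ne: "F \<noteq> {}"
  shows "carrier K = F"
proof -
  obtain S where S: "finite S" "S \<subseteq> carrier K" "lattice_span K S = carrier K"
    and K: "Lattice.lattice K"
    using lb by (auto simp: lower_bounded_lattice_def fin_gen_lattice_def)
  interpret K: Lattice.lattice K by fact
  have subF: "sublattice K F" and FK: "F \<subseteq> carrier K"
    using el by (simp_all add: elementary_sublattice_def sublattice_def)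
  have "S \<noteq> {}"
  proof
    assume "S = {}"
    then have "x \<notin> lattice_span K S" for x
      using lattice_span_least[of K "{}" S] by (auto simp: sublattice_def)
    then show False using S(3) ne FK by auto
  qed
  \<comment> \<open>\<open>free_lat\<close> has a generator for each natural number. The finitely
    many indices in \<open>I\<close> suffice to reach all of \<open>S\<close>, so the lattice
    \<open>T\<close> below is finitely generated and is mapped onto \<open>K\<close>.\<close>
  define \<sigma> where "\<sigma> = from_nat_into S"
  define I where "I = to_nat_on S ` S"
  have \<sigma>: "\<sigma> i \<in> carrier K" for i
    using from_nat_into[OF \<open>S \<noteq> {}\<close>] S(2) by (auto simp: \<sigma>_def)
  have \<sigma>I: "\<sigma> ` I = S"
    using S(1) by (simp add: \<sigma>_def I_def image_image countable_finite)
  obtain h where h: "h \<in> lattice_hom free_lat_order K" and hgen: "\<And>i. h (free_gen i) = \<sigma> i"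
    using free_lat_universal[of K \<sigma>, OF K \<sigma>] by blast
  define T where "T = lattice_span free_lat_order (free_gen ` I)"
  let ?M = "free_lat_order\<lparr>carrier := T\<rparr>"
  have gens: "free_gen ` I \<subseteq> carrier free_lat_order" by (simp add: free_lat_order_def)
  have T: "sublattice free_lat_order T"
    unfolding T_def by (rule sublattice_span[OF free_lat_order_lattice gens])
  note M = sublattice_is_lattice[OF free_lat_order_lattice T]
  have gT: "free_gen ` I \<subseteq> T" by (auto simp: T_def intro: lattice_span.incl)
  have "id ` lattice_span ?M (free_gen ` I) = lattice_span free_lat_order (id ` free_gen ` I)"
    using gT by (intro lattice_hom_span[OF M(2,1)]) simp
  then have "lattice_span ?M (free_gen ` I) = T" by (simp add: T_def)
  moreover have "finite I" using S(1) by (simp add: I_def)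
  ultimately have "fin_gen_lattice ?M"
    unfolding fin_gen_lattice_def using M(1) gT by (intro conjI exI[of _ "free_gen ` I"]) auto
  then have lbh: "lower_bounded_hom ?M K (h \<circ> id)"
    using lattice_hom_comp[OF M(2) h] by (rule lower_bounded_lattice_universal[OF lb])
  have surj: "h ` T = carrier K"
  proof -
    have "h ` T = lattice_span K (h ` free_gen ` I)"
      unfolding T_def by (rule lattice_hom_span[OF h free_lat_order_lattice gens])
    also have "h ` free_gen ` I = S" using \<sigma>I by (simp add: image_image hgen)
    finally show ?thesis using S(3) by simp
  qed
  have "\<exists>m. m \<in> T \<and> a \<sqsubseteq>\<^bsub>K\<^esub> h m \<and> (\<forall>w\<in>T. a \<sqsubseteq>\<^bsub>K\<^esub> h w \<longrightarrow> m \<le> w)" if a: "a \<in> carrier K" for a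
  proof -
    let ?W = "{w \<in> T. a \<sqsubseteq>\<^bsub>K\<^esub> h w}"
    have "a \<in> h ` T" using a surj by simp
    \<comment> \<open>Surjectivity excludes the empty alternative in lower boundedness.\<close>
    then have "?W \<noteq> {}" using a by auto
    moreover have "?W = {} \<or> (\<exists>m. least ?M m ?W)"
      using lbh a by (simp add: lower_bounded_hom_def)
    ultimately obtain m where "least ?M m ?W" by meson
    then show ?thesis by (auto simp: least_def free_lat_order_def)
  qed
  then have "\<forall>a\<in>carrier K. \<exists>m. m \<in> T \<and> a \<sqsubseteq>\<^bsub>K\<^esub> h m \<and> (\<forall>w\<in>T. a \<sqsubseteq>\<^bsub>K\<^esub> h w \<longrightarrow> m \<le> w)"
    by simp
  from bchoice[OF this] obtain \<beta> where \<beta>: "\<forall>a\<in>carrier K. \<beta> a \<in> T \<and> a \<sqsubseteq>\<^bsub>K\<^esub> h (\<beta> a) \<and>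
      (\<forall>w\<in>T. a \<sqsubseteq>\<^bsub>K\<^esub> h w \<longrightarrow> \<beta> a \<le> w)" ..
  interpret G: whitman_generators "free_gen ` I" using \<open>finite I\<close> by (rule free_gens_whitman)
  have closed: "sup x y \<in> T" "inf x y \<in> T" if "x \<in> T" "y \<in> T" for x y
    using T that by (simp_all add: sublattice_def join_free_lat_order meet_free_lat_order)
  have joinsT: "G.joins k \<subseteq> T" for k by (rule G.joins_subset_closed[OF gT closed])
  have h_sup: "h (sup x y) = h x \<squnion>\<^bsub>K\<^esub> h y" for x y
    using h by (simp add: lattice_hom_def join_free_lat_order) (simp add: free_lat_order_def)
  interpret B: lower_bounded_image "free_gen ` I" K T h \<beta>
  proof unfold_locales
    show "h x \<in> carrier K" if "x \<in> T" for x using surj that by blast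
    show "\<exists>x\<in>T. h x = a" if "a \<in> carrier K" for a
      using that unfolding surj[symmetric] by auto
  qed (use joinsT closed \<beta> h_sup in auto)
  \<comment> \<open>The union of the levels is a sublattice containing the generators, so every
    element of \<open>T\<close> lies on some level.\<close>
  have "sublattice free_lat_order (\<Union>k. G.joins k)"
    using G.UN_joins_closed
    by (simp add: sublattice_def join_free_lat_order meet_free_lat_order) (simp add: free_lat_order_def)
  then have Tjoins: "T \<subseteq> (\<Union>k. G.joins k)"
    unfolding T_def by (rule lattice_span_least[OF _ G.gens_subset_UN_joins])
  have "a \<in> F" if a: "a \<in> carrier K" for a
  proof -
    obtain k where "\<beta> a \<in> G.joins k" using bspec[OF \<beta> a] Tjoins by auto
    then have "a \<in> h ` B.betas (G.joins k)" using B.h_beta[OF a] by (intro image_eqI[of _ _ "\<beta> a"]) simp_all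
    moreover have "h ` B.betas (G.joins k) \<subseteq> F"
      by (rule B.h_betas_joins_subset[OF subF elementary_cover_refines[OF K el F ne]])
    ultimately show ?thesis by blast
  qed
  then show ?thesis using FK by blast
qed

theorem theorem6p6:
  fixes K :: "('a, 'm) gorder_scheme" and F X :: "'a set" and n :: nat
  assumes "3 \<le> n"
    and "finite X" and "card X = n"
    and "free_lattice (K\<lparr>carrier := F\<rparr>) X"
    and "fin_gen_lattice K"
    and "elementary_sublattice K F"
    and "lower_bounded_lattice K"
  shows "(\<forall>u. join_irred K u \<and> u \<in> carrier K - F \<longrightarrow>
            \<not> ((\<exists>v. join_irred K v \<and> v \<in> carrier K - F \<and> D_rel K u v) \<or>
               infinite {v \<in> F. D_rel K u v})) \<and>
         carrier K = F"
proof -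
  have "fin_gen_lattice (K\<lparr>carrier := F\<rparr>)"
    using assms(2,4) unfolding free_lattice_def fin_gen_lattice_def by blast
  moreover have "F \<noteq> {}" using assms(1-4) by (auto simp: free_lattice_def)
  ultimately have "carrier K = F"
    using lower_bounded_elementary_extension assms(6,7) by blast
  \<comment> \<open>No \<open>u\<close> is left in \<open>carrier K - F\<close>, so the claim about
    join irreducibles holds vacuously.\<close>
  then show ?thesis by simp
qed

end
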